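(* For infinitely many $n$ there exists an instance of LogBgt-Path of size $n$ such that the integrality gap of LP-LBO-Path is $\Omega(\log n)$. Thus the natural linear programming relaxations of both LogBgt-Path (LP-LBO-Path) and LogBgt-PerMat (LP-LBO-PM) have integrality gaps $\Omega(\log n)$.
   Context: For a ground set of size $n$, $T=\lceil\log_2 n\rceil$. LogBgt-Path instance: directed graph $(V,E)$, vertices $s,t$, ground set $E$ with $n=|E|$, pairwise disjoint $S_1,\dots,S_T\subseteq E$. LP-LBO-Path: minimize $z$ subject to $\sum_{j:(i,j)\in E}x_{i,j}-\sum_{j:(j,i)\in E}x_{j,i}=0$ for all $i\in V\setminus\{s,t\}$; $\sum_{j:(s,j)\in E}x_{s,j}=1$; $\sum_{i:(i,t)\in E}x_{i,t}=1$; $\sum_{e\in S_i}x_e\le z\cdot2^i$ for $1\le i\le T$; $0\le x_e\le1$. LogBgt-PerMat instance: bipartite graph $(L,R,E)$, $|L|=|R|$, ground set $E$, disjoint $S_1,\dots,S_T\subseteq E$. LP-LBO-PM: minimize $z$ subject to $\sum_{i:(i,j)\in E}x_{i,j}=1$ for all $j\in R$, $\sum_{j:(i,j)\in E}x_{i,j}=1$ for all $i\in L$, $\sum_{e\in S_i}x_e\le z2^i$ for all $i$, $0\le x\le1$. The integrality gap is the ratio of the optimum over integral $x$ to the optimum over fractional $x$. *)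

theory Defs
  imports "HOL-Analysis.Analysis" "HOL-Library.Disjoint_Sets" "Graph_Theory.Pair_Digraph"
begin

definition num_budgets :: "nat \<Rightarrow> nat" where
  "num_budgets n = nat \<lceil>log 2 (real n)\<rceil>"

text \<open>Only the values \<open>S i\<close> with \<open>1 \<le> i \<le> num_budgets (card E)\<close> are relevant.
  The sets need not cover the ground set, and some of them may be empty.\<close>

definition budget_sets :: "'e set \<Rightarrow> (nat \<Rightarrow> 'e set) \<Rightarrow> bool" where
  "budget_sets E S \<longleftrightarrow>
     (\<forall>i\<in>{1..num_budgets (card E)}. S i \<subseteq> E) \<and>
     disjoint_family_on S {1..num_budgets (card E)}"

definition budget_constraints ::
  "'e set \<Rightarrow> (nat \<Rightarrow> 'e set) \<Rightarrow> ('e \<Rightarrow> real) \<Rightarrow> real \<Rightarrow> bool" where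
  "budget_constraints E S x z \<longleftrightarrow>
     (\<forall>i\<in>{1..num_budgets (card E)}. (\<Sum>e\<in>S i. x e) \<le> z * 2 ^ i)"


definition LogBgt_Path_instance ::
  "'v pair_pre_digraph \<Rightarrow> 'v \<Rightarrow> 'v \<Rightarrow> (nat \<Rightarrow> ('v \<times> 'v) set) \<Rightarrow> bool" where
  "LogBgt_Path_instance G s t S \<longleftrightarrow>
     pair_digraph G \<and> s \<in> pverts G \<and> t \<in> pverts G \<and> s \<noteq> t \<and> budget_sets (parcs G) S"

definition LP_LBO_Path ::
  "'v pair_pre_digraph \<Rightarrow> 'v \<Rightarrow> 'v \<Rightarrow> (nat \<Rightarrow> ('v \<times> 'v) set) \<Rightarrow> ('v \<times> 'v \<Rightarrow> real) \<Rightarrow> real \<Rightarrow> bool" where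
  "LP_LBO_Path G s t S x z \<longleftrightarrow>
     (\<forall>i\<in>pverts G - {s, t}.
        (\<Sum>j | (i, j) \<in> parcs G. x (i, j)) - (\<Sum>j | (j, i) \<in> parcs G. x (j, i)) = 0) \<and>
     (\<Sum>j | (s, j) \<in> parcs G. x (s, j)) = 1 \<and>
     (\<Sum>i | (i, t) \<in> parcs G. x (i, t)) = 1 \<and>
     budget_constraints (parcs G) S x z \<and>
     (\<forall>e\<in>parcs G. 0 \<le> x e \<and> x e \<le> 1)"


text \<open>An edge of the bipartite graph is the pair of its endpoint in \<open>L\<close> and its endpoint in \<open>R\<close>.\<close>

definition LogBgt_PerMat_instance ::
  "'v set \<Rightarrow> 'v set \<Rightarrow> ('v \<times> 'v) set \<Rightarrow> (nat \<Rightarrow> ('v \<times> 'v) set) \<Rightarrow> bool" where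
  "LogBgt_PerMat_instance L R E S \<longleftrightarrow>
     finite L \<and> finite R \<and> L \<inter> R = {} \<and> card L = card R \<and> E \<subseteq> L \<times> R \<and> budget_sets E S"

definition LP_LBO_PM ::
  "'v set \<Rightarrow> 'v set \<Rightarrow> ('v \<times> 'v) set \<Rightarrow> (nat \<Rightarrow> ('v \<times> 'v) set) \<Rightarrow> ('v \<times> 'v \<Rightarrow> real) \<Rightarrow> real \<Rightarrow> bool" where
  "LP_LBO_PM L R E S x z \<longleftrightarrow>
     (\<forall>j\<in>R. (\<Sum>i | (i, j) \<in> E. x (i, j)) = 1) \<and>
     (\<forall>i\<in>L. (\<Sum>j | (i, j) \<in> E. x (i, j)) = 1) \<and>
     budget_constraints E S x z \<and>
     (\<forall>e\<in>E. 0 \<le> x e \<and> x e \<le> 1)"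


text \<open>Below, \<open>P x z\<close> says that \<open>(x, z)\<close> is feasible; the objective is \<open>z\<close>.
  In the integral problem only \<open>x\<close> is required to be integral, \<open>z\<close> remains real.
  The real-valued infimum is meaningful only for problems that are feasible and bounded below.
  Both relaxations are bounded below by 0 once the ground set has at least two elements
  (there is then at least one budget constraint); feasibility has to be required separately.\<close>

definition integral_on :: "'e set \<Rightarrow> ('e \<Rightarrow> real) \<Rightarrow> bool" where
  "integral_on E x \<longleftrightarrow> (\<forall>e\<in>E. x e \<in> \<int>)"

definition fractional_opt :: "(('e \<Rightarrow> real) \<Rightarrow> real \<Rightarrow> bool) \<Rightarrow> real" where
  "fractional_opt P = Inf {z. \<exists>x. P x z}"

definition integral_opt :: "'e set \<Rightarrow> (('e \<Rightarrow> real) \<Rightarrow> real \<Rightarrow> bool) \<Rightarrow> real" where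
  "integral_opt E P = Inf {z. \<exists>x. integral_on E x \<and> P x z}"

definition integrality_gap :: "'e set \<Rightarrow> (('e \<Rightarrow> real) \<Rightarrow> real \<Rightarrow> bool) \<Rightarrow> real" where
  "integrality_gap E P = integral_opt E P / fractional_opt P"

text \<open>The gap is a genuine ratio: an integral solution exists and the denominator is positive.\<close>

definition gap_well_defined :: "'e set \<Rightarrow> (('e \<Rightarrow> real) \<Rightarrow> real \<Rightarrow> bool) \<Rightarrow> bool" where
  "gap_well_defined E P \<longleftrightarrow> (\<exists>x z. integral_on E x \<and> P x z) \<and> 0 < fractional_opt P"

end

theory Submission
  imports Defs
begin

text \<open>Take \<open>m\<close> internally disjoint \<open>s\<close>-\<open>t\<close> paths, the \<open>i\<close>-th of which has \<open>m * 2 ^ i\<close> arcs, all of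
  them in \<open>S\<^sub>i\<close>. A unit flow is a convex combination of these paths. Spreading it evenly gives
  \<open>z = 1\<close>, whereas an integral flow uses a single path completely and so forces \<open>z \<ge> m\<close>; and \<open>m\<close>
  is of the order of the logarithm of the number of arcs. Splitting every internal vertex \<open>v\<close> into
  a left and a right copy joined by an edge turns unit flows into fractional perfect matchings,
  the edge at \<open>v\<close> carrying the complement of the flow through \<open>v\<close>.\<close>

section \<open>The gap forced by parallel branches\<close>

text \<open>\<open>Q\<close> collects the constraints that do not involve the budgets.\<close>

lemma integrality_gap_branches:
  fixes E :: "'e set" and B :: "nat \<Rightarrow> 'e set" and Q :: "('e \<Rightarrow> real) \<Rightarrow> bool"
  assumes fin: "finite E" and m: "m \<ge> 1"
    and disj: "disjoint_family_on B {1..m}"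
    and sub: "\<And>i. i \<in> {1..m} \<Longrightarrow> B i \<subseteq> E"
    and card_B: "\<And>i. i \<in> {1..m} \<Longrightarrow> card (B i) = m * 2 ^ i"
    and card_E: "card E \<le> 2 ^ (5 * m)"
    and P: "\<And>x z. P x z \<longleftrightarrow> Q x \<and> budget_constraints E (\<lambda>i. if i \<in> {1..m} then B i else {}) x z"
    and decompose: "\<And>x. Q x \<Longrightarrow>
      \<exists>y. (\<forall>i\<in>{1..m}. 0 \<le> y i) \<and> sum y {1..m} = 1 \<and> (\<forall>i\<in>{1..m}. \<forall>e\<in>B i. x e = y i)"
    and compose: "\<And>y. \<forall>i\<in>{1..m}. 0 \<le> y i \<Longrightarrow> sum y {1..m} = 1 \<Longrightarrow>
      \<exists>x. Q x \<and> (\<forall>i\<in>{1..m}. \<forall>e\<in>B i. x e = y i) \<and>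
          ((\<forall>i\<in>{1..m}. y i \<in> \<int>) \<longrightarrow> integral_on E x)"
  shows "budget_sets E (\<lambda>i. if i \<in> {1..m} then B i else {})"
    and "gap_well_defined E P"
    and "integrality_gap E P \<ge> 1 / 5 * log 2 (real (card E))"
    and "m \<le> card E"
proof -
  let ?S = "\<lambda>i. if i \<in> {1..m} then B i else {}"
  \<comment> \<open>The longest branch alone bounds \<open>card E\<close> from below. This places
    all indices \<open>1..m\<close> in the range of \<open>num_budgets\<close>, so every branch
    carries a genuine budget, and it also makes the sizes unbounded in \<open>m\<close>.\<close>
  have "card (B m) \<le> card E"
    using sub[of m] m fin by (intro card_mono) auto
  then have E_ge: "m * 2 ^ m \<le> card E"
    using card_B[of m] m by simp
  moreover have "(2::nat) ^ m \<le> m * 2 ^ m" and "m \<le> m * 2 ^ m"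
    using m by simp_all
  ultimately have E_ge': "2 ^ m \<le> card E" and E_ge_m: "m \<le> card E"
    by linarith+
  show "m \<le> card E" by (fact E_ge_m)
  have pos: "0 < card E"
    using E_ge_m m by simp
  have "real m \<le> log 2 (real (card E))"
  proof -
    have "(2::real) ^ m \<le> real (card E)"
      using E_ge' by (metis of_nat_le_iff of_nat_numeral of_nat_power)
    then show ?thesis
      using pos by (simp add: le_log_iff powr_realpow)
  qed
  then have num_ge: "m \<le> num_budgets (card E)"
    unfolding num_budgets_def by linarith
  \<comment> \<open>The upper bound on the size converts a gap of \<open>m\<close> into a fifth of
    the logarithm.\<close>
  have log_le: "log 2 (real (card E)) \<le> 5 * real m"
  proof -
    have "real (card E) \<le> 2 ^ (5 * m)"
      using card_E by (metis of_nat_le_iff of_nat_numeral of_nat_power)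
    then have "real (card E) \<le> 2 powr real (5 * m)"
      by (simp only: powr_realpow[of 2 "5 * m"])
    then show ?thesis
      using pos by (simp add: log_le_iff)
  qed
  show "budget_sets E ?S"
    unfolding budget_sets_def using sub disj by (auto simp: disjoint_family_on_def)
  \<comment> \<open>A branch with constant value \<open>y i\<close> has weight
    \<open>m * 2 ^ i * y i\<close>, so the factor \<open>2 ^ i\<close> cancels against its budget
    and all branches cost the same.\<close>
  have lower: "real m * y i \<le> z"
    if "P x z" "i \<in> {1..m}" "\<forall>e\<in>B i. x e = y i" for x y z i
  proof -
    have "(\<Sum>e\<in>?S i. x e) \<le> z * 2 ^ i"
      using that(1,2) num_ge unfolding P budget_constraints_def by (meson atLeastAtMost_iff le_trans)
    moreover have "(\<Sum>e\<in>?S i. x e) = real m * 2 ^ i * y i"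
      using that card_B[of i] by simp
    ultimately have "(real m * y i) * 2 ^ i \<le> z * 2 ^ i"
      by (simp add: mult_ac)
    then show ?thesis
      by simp
  qed
  \<comment> \<open>For indices above \<open>m\<close> the budget set is empty; there the constraint
    reads \<open>0 \<le> z * 2 ^ i\<close>, which is where \<open>0 \<le> z\<close> enters.\<close>
  have upper: "budget_constraints E ?S x z"
    if "\<forall>i\<in>{1..m}. \<forall>e\<in>B i. x e = y i" "\<forall>i\<in>{1..m}. real m * y i \<le> z" "0 \<le> z" for x y z
    unfolding budget_constraints_def
  proof
    fix i assume "i \<in> {1..num_budgets (card E)}"
    show "(\<Sum>e\<in>?S i. x e) \<le> z * 2 ^ i"
    proof (cases "i \<in> {1..m}")
      case True
      then have "(\<Sum>e\<in>?S i. x e) = (real m * y i) * 2 ^ i"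
        using that(1) card_B[of i] by simp
      also have "\<dots> \<le> z * 2 ^ i"
        using that(2) True by (intro mult_right_mono) auto
      finally show ?thesis .
    qed (use that(3) in auto)
  qed
  \<comment> \<open>Averaging: the \<open>m\<close> quantities \<open>m * y i\<close> sum to
    \<open>m\<close>, and each is at most \<open>z\<close>.\<close>
  have frac_ge: "1 \<le> z" if "P x z" for x z
  proof -
    obtain y where y: "sum y {1..m} = 1" "\<forall>i\<in>{1..m}. \<forall>e\<in>B i. x e = y i"
      using decompose \<open>P x z\<close> P by blast
    have "(\<Sum>i\<in>{1..m}. real m * y i) \<le> (\<Sum>i\<in>{1..m}. z)"
      using lower[OF that] y(2) by (intro sum_mono) blast
    then have "real m * 1 \<le> real m * z"
      by (simp add: sum_distrib_left[symmetric] y(1)[simplified])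
    then show ?thesis
      using m by simp
  qed
  \<comment> \<open>Some \<open>y i\<close> is nonzero; being a nonnegative integer it is at least
    1, so its budget alone forces \<open>z\<close> up to \<open>m\<close>.\<close>
  have int_ge: "real m \<le> z" if "P x z" "integral_on E x" for x z
  proof -
    obtain y where y: "\<forall>i\<in>{1..m}. 0 \<le> y i" "sum y {1..m} = 1"
        "\<forall>i\<in>{1..m}. \<forall>e\<in>B i. x e = y i"
      using decompose \<open>P x z\<close> P by blast
    obtain i where i: "i \<in> {1..m}" "y i \<noteq> 0"
      using y(2) by (metis sum.neutral zero_neq_one)
    \<comment> \<open>Integrality is known for \<open>x\<close> only; an element of the branch
      transfers it to \<open>y i\<close>.\<close>
    have "B i \<noteq> {}"
      using card_B[OF i(1)] m by auto
    then obtain e where "e \<in> B i" by blast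
    then have "y i \<in> \<int>"
      using y(3) i(1) sub[OF i(1)] that(2) unfolding integral_on_def by (metis subsetD)
    then obtain k where k: "y i = of_int k"
      by (elim Ints_cases)
    have "0 < y i"
      using i y(1) by (simp add: less_le)
    then have "1 \<le> y i"
      unfolding k by simp
    then have "real m * 1 \<le> real m * y i"
      by (intro mult_left_mono) auto
    also have "\<dots> \<le> z"
      using lower[OF that(1) i(1)] y(3) i(1) by blast
    finally show ?thesis by simp
  qed
  \<comment> \<open>The even spread \<open>1 / m\<close> attains the fractional bound.\<close>
  obtain x where "P x 1"
  proof -
    obtain x where "Q x" "\<forall>i\<in>{1..m}. \<forall>e\<in>B i. x e = 1 / real m"
      using compose[of "\<lambda>_. 1 / real m"] m by auto
    moreover from this(2) have "budget_constraints E ?S x 1"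
      by (rule upper) (use m in auto)
    ultimately show ?thesis
      using that P by blast
  qed
  \<comment> \<open>Routing everything through branch 1 shows that the integral problem is feasible,
    so its infimum ranges over a nonempty set.\<close>
  obtain w where w: "P w (real m)" "integral_on E w"
  proof -
    let ?y = "\<lambda>i::nat. if i = 1 then 1 else 0 :: real"
    have y: "\<forall>i\<in>{1..m}. 0 \<le> ?y i" "sum ?y {1..m} = 1" "\<forall>i\<in>{1..m}. ?y i \<in> \<int>"
      using m by simp_all
    obtain w where "Q w" "\<forall>i\<in>{1..m}. \<forall>e\<in>B i. w e = ?y i" "integral_on E w"
      using compose[OF y(1,2)] y(3) by blast
    moreover from this(2) have "budget_constraints E ?S w (real m)"
      by (rule upper) auto
    ultimately show ?thesis
      using that P by blast
  qed
  have frac_bounds: "1 \<le> fractional_opt P" "fractional_opt P \<le> 1"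
    unfolding fractional_opt_def
    using \<open>P x 1\<close> frac_ge by (auto intro!: cInf_greatest cInf_lower bdd_belowI[of _ 1])
  then show "gap_well_defined E P"
    unfolding gap_well_defined_def using w by auto
  have "real m \<le> integral_opt E P"
    unfolding integral_opt_def using w int_ge by (auto intro!: cInf_greatest)
  moreover have "fractional_opt P = 1"
    using frac_bounds by linarith
  ultimately show "integrality_gap E P \<ge> 1 / 5 * log 2 (real (card E))"
    unfolding integrality_gap_def using log_le by simp
qed

section \<open>Unit flows on parallel branches\<close>

text \<open>The budget-free part of the path relaxation; it plays the role of \<open>Q\<close> for
  paths.\<close>

definition unit_flow :: "'v set \<Rightarrow> ('v \<times> 'v) set \<Rightarrow> 'v \<Rightarrow> 'v \<Rightarrow> ('v \<times> 'v \<Rightarrow> real) \<Rightarrow> bool" where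
  "unit_flow V A s t x \<longleftrightarrow>
     (\<forall>v\<in>V - {s, t}. (\<Sum>w | (v, w) \<in> A. x (v, w)) = (\<Sum>u | (u, v) \<in> A. x (u, v))) \<and>
     (\<Sum>w | (s, w) \<in> A. x (s, w)) = 1 \<and>
     (\<Sum>u | (u, t) \<in> A. x (u, t)) = 1 \<and>
     (\<forall>e\<in>A. 0 \<le> x e \<and> x e \<le> 1)"

lemma LP_LBO_Path_iff:
  "LP_LBO_Path G s t S x z \<longleftrightarrow>
     unit_flow (pverts G) (parcs G) s t x \<and> budget_constraints (parcs G) S x z"
  unfolding LP_LBO_Path_def unit_flow_def by auto

text \<open>Vertex 0 is the source, 1 the sink, and \<open>node m i k\<close> the \<open>k\<close>-th vertex of branch \<open>i\<close>.\<close>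

definition node :: "nat \<Rightarrow> nat \<Rightarrow> nat \<Rightarrow> nat" where
  "node m i k = (if k = 0 then 0 else if k = m * 2 ^ i then 1 else 2 + prod_encode (i, k))"

definition branch :: "nat \<Rightarrow> nat \<Rightarrow> (nat \<times> nat) set" where
  "branch m i = (\<lambda>k. (node m i k, node m i (Suc k))) ` {..<m * 2 ^ i}"

definition branch_arcs :: "nat \<Rightarrow> (nat \<times> nat) set" where
  "branch_arcs m = (\<Union>i\<in>{1..m}. branch m i)"

text \<open>Collecting endpoints of arcs rules out isolated vertices, so every vertex other than
  source and sink is internal to a branch.\<close>

definition branch_verts :: "nat \<Rightarrow> nat set" where
  "branch_verts m = fst ` branch_arcs m \<union> snd ` branch_arcs m"

section \<open>Vertex numbering, distinctness and number of the arcs\<close>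

lemma node_0 [simp]: "node m i 0 = 0"
  by (simp add: node_def)

lemma node_end: "m \<ge> 1 \<Longrightarrow> node m i (m * 2 ^ i) = 1"
  by (simp add: node_def)

lemma node_eq_0_iff [simp]: "node m i k = 0 \<longleftrightarrow> k = 0"
  by (simp add: node_def)

lemma node_eq_1_iff: "m \<ge> 1 \<Longrightarrow> node m i k = 1 \<longleftrightarrow> k = m * 2 ^ i"
  by (simp add: node_def)

text \<open>The code \<open>prod_encode\<close> is injective, and its shift by 2 keeps internal
  vertices apart from source and sink; hence an internal vertex determines its branch and its
  position.\<close>

lemma node_eq_internal_iff:
  "0 < k \<Longrightarrow> k < m * 2 ^ i \<Longrightarrow> node m i' k' = node m i k \<longleftrightarrow> i' = i \<and> k' = k"
  by (auto simp: node_def)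

text \<open>Guarantees an internal vertex on each branch. A branch of length 1 would be the bare arc
  from source to sink, which does not reveal its branch.\<close>

lemma branch_length_ge_2:
  fixes m i :: nat
  assumes "m \<ge> 1" "i \<ge> 1"
  shows "2 \<le> m * 2 ^ i"
proof -
  have "(2::nat) ^ 1 \<le> 2 ^ i"
    using assms by (intro power_increasing) auto
  then show ?thesis
    using mult_le_mono[of 1 m 2 "2 ^ i"] assms by simp
qed

lemma branch_arcsE:
  assumes "e \<in> branch_arcs m"
  obtains i k where "i \<in> {1..m}" "k < m * 2 ^ i" "e = (node m i k, node m i (Suc k))"
  using assms unfolding branch_arcs_def branch_def by auto

lemma branch_arcsI:
  "i \<in> {1..m} \<Longrightarrow> k < m * 2 ^ i \<Longrightarrow> (node m i k, node m i (Suc k)) \<in> branch_arcs m"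
  unfolding branch_arcs_def branch_def by blast

text \<open>One endpoint of each arc is internal: the tail if \<open>k > 0\<close>, and otherwise
  the head, since the branch has length at least 2. That endpoint identifies the arc.\<close>

lemma branch_arc_eqD:
  assumes "m \<ge> 1" "i \<ge> 1" "k < m * 2 ^ i"
    and "(node m i' k', node m i' (Suc k')) = (node m i k, node m i (Suc k))"
  shows "i' = i \<and> k' = k"
proof (cases "k = 0")
  case True
  then have "Suc k < m * 2 ^ i"
    using branch_length_ge_2[OF assms(1,2)] by simp
  then show ?thesis
    using assms(4) node_eq_internal_iff[of "Suc k" m i i' "Suc k'"] by simp
next
  case False
  then show ?thesis
    using assms(3,4) node_eq_internal_iff[of k m i i' k'] by simp
qed

lemma finite_branch_arcs [simp]: "finite (branch_arcs m)"
  unfolding branch_arcs_def branch_def by auto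

lemma card_branch:
  assumes "m \<ge> 1" "i \<ge> 1"
  shows "card (branch m i) = m * 2 ^ i"
proof -
  have "inj_on (\<lambda>k. (node m i k, node m i (Suc k))) {..<m * 2 ^ i}"
    using branch_arc_eqD[OF assms] by (meson inj_onI lessThan_iff)
  then show ?thesis
    unfolding branch_def by (simp add: card_image)
qed

lemma disjoint_branches:
  assumes "m \<ge> 1"
  shows "disjoint_family_on (branch m) {1..m}"
  unfolding disjoint_family_on_def
proof (intro ballI impI)
  fix i j assume ij: "i \<in> {1..m}" "j \<in> {1..m}" "i \<noteq> j"
  show "branch m i \<inter> branch m j = {}"
  proof (rule equals0I)
    fix e assume "e \<in> branch m i \<inter> branch m j"
    then obtain k l where "k < m * 2 ^ i" "e = (node m i k, node m i (Suc k))"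
        "e = (node m j l, node m j (Suc l))"
      unfolding branch_def by auto
    then show False
      using branch_arc_eqD[of m i k j l] ij assms by auto
  qed
qed

text \<open>A crude estimate suffices: replacing every branch by the longest and \<open>m\<close> by
  \<open>2 ^ m\<close> only affects the constant in the exponent.\<close>

lemma card_branch_arcs_le:
  assumes "m \<ge> 1"
  shows "card (branch_arcs m) \<le> 2 ^ (3 * m)"
proof -
  have "card (branch_arcs m) \<le> (\<Sum>i\<in>{1..m}. card (branch m i))"
    unfolding branch_arcs_def by (rule card_UN_le) simp
  also have "\<dots> \<le> (\<Sum>i\<in>{1..m}. m * 2 ^ m)"
    using assms by (intro sum_mono) (simp add: card_branch power_increasing)
  also have "\<dots> = m * m * 2 ^ m"
    by simp
  also have "\<dots> \<le> 2 ^ m * 2 ^ m * 2 ^ m"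
    by (intro mult_le_mono) (simp_all add: less_imp_le)
  also have "\<dots> = 2 ^ (3 * m)"
    by (simp add: power_add[symmetric])
  finally show ?thesis .
qed

lemma branch_vertsE:
  assumes "v \<in> branch_verts m" "m \<ge> 1"
  obtains "v = 0" | "v = 1" | i k where "i \<in> {1..m}" "0 < k" "k < m * 2 ^ i" "v = node m i k"
proof -
  obtain i k where ik: "i \<in> {1..m}" "k \<le> m * 2 ^ i" "v = node m i k"
  proof -
    obtain e where e: "e \<in> branch_arcs m" "v = fst e \<or> v = snd e"
      using assms(1) unfolding branch_verts_def by blast
    then obtain i k where "i \<in> {1..m}" "k < m * 2 ^ i" "e = (node m i k, node m i (Suc k))"
      by (elim branch_arcsE)
    then show thesis
      using e(2) that[of i k] that[of i "Suc k"] by auto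
  qed
  consider "k = 0" | "k = m * 2 ^ i" | "0 < k" "k < m * 2 ^ i"
    using ik(2) by linarith
  then show thesis
    using that ik node_end[OF assms(2)] by cases (metis node_0)+
qed

section \<open>Neighbourhoods and boundary sums\<close>

lemma branch_arcs_successors:
  assumes "i \<in> {1..m}" "0 < k" "k < m * 2 ^ i"
  shows "{w. (node m i k, w) \<in> branch_arcs m} = {node m i (Suc k)}"
  using assms
  by (auto intro!: branch_arcsI elim!: branch_arcsE simp: node_eq_internal_iff eq_commute[of "node m i k"])

text \<open>Together with the unique successor, this reduces conservation at an internal vertex to
  the equality of two consecutive arc values.\<close>

lemma branch_arcs_predecessors:
  assumes "i \<in> {1..m}" "Suc k < m * 2 ^ i"
  shows "{u. (u, node m i (Suc k)) \<in> branch_arcs m} = {node m i k}"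
  using assms
  by (auto intro!: branch_arcsI elim!: branch_arcsE simp: node_eq_internal_iff eq_commute[of "node m i (Suc k)"])

text \<open>The second vertices of the branches are internal, hence pairwise distinct, so a sum over
  heads can be reindexed by branches. The sink is treated symmetrically through the last internal
  vertices.\<close>

lemma sum_branch_arcs_source:
  fixes x :: "nat \<times> nat \<Rightarrow> real"
  assumes "m \<ge> 1"
  shows "(\<Sum>w | (0, w) \<in> branch_arcs m. x (0, w)) = (\<Sum>i\<in>{1..m}. x (node m i 0, node m i 1))"
proof -
  have len: "1 < m * 2 ^ i" if "i \<in> {1..m}" for i
    using branch_length_ge_2[of m i] assms that by auto
  have "{w. (0, w) \<in> branch_arcs m} = (\<lambda>i. node m i 1) ` {1..m}"
  proof (intro equalityI subsetI)
    fix w assume "w \<in> {w. (0, w) \<in> branch_arcs m}"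
    then show "w \<in> (\<lambda>i. node m i 1) ` {1..m}"
      by (auto elim!: branch_arcsE)
  next
    fix w assume "w \<in> (\<lambda>i. node m i 1) ` {1..m}"
    then obtain i where "i \<in> {1..m}" "w = node m i 1" by blast
    then show "w \<in> {w. (0, w) \<in> branch_arcs m}"
      using branch_arcsI[of i m 0] len[of i] by simp
  qed
  moreover have "inj_on (\<lambda>i. node m i 1) {1..m}"
    by (rule inj_onI) (metis len node_eq_internal_iff zero_less_one)
  ultimately show ?thesis
    by (simp add: sum.reindex)
qed

lemma sum_branch_arcs_sink:
  fixes x :: "nat \<times> nat \<Rightarrow> real"
  assumes "m \<ge> 1"
  shows "(\<Sum>u | (u, 1) \<in> branch_arcs m. x (u, 1)) =
    (\<Sum>i\<in>{1..m}. x (node m i (m * 2 ^ i - 1), node m i (m * 2 ^ i)))"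
proof -
  have len: "0 < m * 2 ^ i - 1" "m * 2 ^ i - 1 < m * 2 ^ i" if "i \<in> {1..m}" for i
    using branch_length_ge_2[of m i] assms that by auto
  have "{u. (u, 1) \<in> branch_arcs m} = (\<lambda>i. node m i (m * 2 ^ i - 1)) ` {1..m}"
  proof (intro equalityI subsetI)
    fix u assume "u \<in> {u. (u, 1) \<in> branch_arcs m}"
    then obtain i k where ik: "i \<in> {1..m}" "u = node m i k" "node m i (Suc k) = 1"
      by (auto elim!: branch_arcsE)
    then have "k = m * 2 ^ i - 1"
      by (metis assms diff_Suc_1 node_eq_1_iff)
    then show "u \<in> (\<lambda>i. node m i (m * 2 ^ i - 1)) ` {1..m}"
      using ik by blast
  next
    fix u assume "u \<in> (\<lambda>i. node m i (m * 2 ^ i - 1)) ` {1..m}"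
    then obtain i where "i \<in> {1..m}" "u = node m i (m * 2 ^ i - 1)" by blast
    then show "u \<in> {u. (u, 1) \<in> branch_arcs m}"
      using branch_arcsI[of i m "m * 2 ^ i - 1"] len[of i] node_end[OF assms, of i] by simp
  qed
  moreover have "inj_on (\<lambda>i. node m i (m * 2 ^ i - 1)) {1..m}"
    by (rule inj_onI) (metis len node_eq_internal_iff)
  ultimately show ?thesis
    using node_end[OF assms] by (simp add: sum.reindex)
qed

text \<open>Conservation carries the value of the first arc along its branch, and the source
  constraint makes these values sum to 1. Conversely, constant values on branches are conserved, and
  their sum is both the outflow of the source and the inflow of the sink.\<close>

lemma unit_flow_branches_iff:
  assumes m: "m \<ge> 1"
  shows "unit_flow (branch_verts m) (branch_arcs m) 0 1 x \<longleftrightarrow>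
    (\<exists>y. (\<forall>i\<in>{1..m}. 0 \<le> y i) \<and> sum y {1..m} = 1 \<and> (\<forall>i\<in>{1..m}. \<forall>e\<in>branch m i. x e = y i))"
    (is "?flow \<longleftrightarrow> ?comb")
proof
  assume flow: ?flow
  have const: "x (node m i k, node m i (Suc k)) = x (node m i 0, node m i 1)"
    if "i \<in> {1..m}" "k < m * 2 ^ i" for i k
    using that(2)
  proof (induction k)
    case (Suc k)
    have "node m i (Suc k) \<in> branch_verts m - {0, 1}"
      using branch_arcsI[OF that(1), of k] Suc.prems node_eq_1_iff[OF m, of i "Suc k"]
      unfolding branch_verts_def by force
    then have "(\<Sum>w | (node m i (Suc k), w) \<in> branch_arcs m. x (node m i (Suc k), w)) =
        (\<Sum>u | (u, node m i (Suc k)) \<in> branch_arcs m. x (u, node m i (Suc k)))"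
      using flow unfolding unit_flow_def by blast
    then have "x (node m i (Suc k), node m i (Suc (Suc k))) = x (node m i k, node m i (Suc k))"
      using Suc.prems that(1) by (simp add: branch_arcs_successors branch_arcs_predecessors)
    then show ?case
      using Suc by simp
  qed simp
  show ?comb
  proof (intro exI[of _ "\<lambda>i. x (node m i 0, node m i 1)"] conjI ballI)
    fix i assume "i \<in> {1..m}"
    then show "0 \<le> x (node m i 0, node m i 1)"
      using flow branch_arcsI[of i m 0] m unfolding unit_flow_def by auto
  next
    show "(\<Sum>i\<in>{1..m}. x (node m i 0, node m i 1)) = 1"
      using flow sum_branch_arcs_source[OF m] unfolding unit_flow_def by simp
  next
    fix i e assume "i \<in> {1..m}" "e \<in> branch m i"
    then show "x e = x (node m i 0, node m i 1)"
      using const unfolding branch_def by auto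
  qed
next
  assume ?comb
  then obtain y where y: "\<forall>i\<in>{1..m}. 0 \<le> y i" "sum y {1..m} = 1"
      "\<forall>i\<in>{1..m}. \<forall>e\<in>branch m i. x e = y i"
    by blast
  have val: "x (node m i k, node m i (Suc k)) = y i" if "i \<in> {1..m}" "k < m * 2 ^ i" for i k
    using y(3) that unfolding branch_def by blast
  \<comment> \<open>The upper bound on each arc follows from nonnegativity and total 1.\<close>
  have y_le: "y i \<le> 1" if "i \<in> {1..m}" for i
    using member_le_sum[of i "{1..m}" y] y that by simp
  show ?flow
    unfolding unit_flow_def
  proof (intro conjI ballI)
    fix v assume "v \<in> branch_verts m - {0, 1}"
    then obtain i k where ik: "i \<in> {1..m}" "0 < k" "k < m * 2 ^ i" "v = node m i k"
      using m by (blast elim: branch_vertsE)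
    then obtain l where l: "k = Suc l"
      using gr0_implies_Suc by blast
    show "(\<Sum>w | (v, w) \<in> branch_arcs m. x (v, w)) = (\<Sum>u | (u, v) \<in> branch_arcs m. x (u, v))"
      using ik val[of i k] val[of i l]
      by (simp add: l branch_arcs_successors branch_arcs_predecessors)
  next
    have "(\<Sum>i\<in>{1..m}. x (node m i 0, node m i 1)) = sum y {1..m}"
      using val[of _ 0] m by (intro sum.cong) auto
    then show "(\<Sum>w | (0, w) \<in> branch_arcs m. x (0, w)) = 1"
      using sum_branch_arcs_source[OF m] y(2) by simp
  next
    have "(\<Sum>i\<in>{1..m}. x (node m i (m * 2 ^ i - 1), node m i (m * 2 ^ i))) = sum y {1..m}"
    proof (rule sum.cong)
      fix i assume "i \<in> {1..m}"
      then show "x (node m i (m * 2 ^ i - 1), node m i (m * 2 ^ i)) = y i"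
        using val[of i "m * 2 ^ i - 1"] m by simp
    qed simp
    then show "(\<Sum>u | (u, 1) \<in> branch_arcs m. x (u, 1)) = 1"
      using sum_branch_arcs_sink[OF m] y(2) by simp
  next
    fix e assume "e \<in> branch_arcs m"
    then obtain i where "i \<in> {1..m}" "e \<in> branch m i"
      unfolding branch_arcs_def by blast
    then show "0 \<le> x e" "x e \<le> 1"
      using y y_le by auto
  qed
qed

lemma ex_unit_flow_branches:
  assumes m: "m \<ge> 1" and y: "\<forall>i\<in>{1..m}. 0 \<le> y i" "sum y {1..m} = 1"
  shows "\<exists>x. unit_flow (branch_verts m) (branch_arcs m) 0 1 x \<and>
    (\<forall>i\<in>{1..m}. \<forall>e\<in>branch m i. x e = y i) \<and>
    ((\<forall>i\<in>{1..m}. y i \<in> \<int>) \<longrightarrow> integral_on (branch_arcs m) x)"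
proof -
  \<comment> \<open>By disjointness of the branches this sum has exactly one term on each arc, so it
    glues the prescribed branch values into one function.\<close>
  define x where "x e = (\<Sum>i | i \<in> {1..m} \<and> e \<in> branch m i. y i)" for e
  have x: "x e = y i" if "i \<in> {1..m}" "e \<in> branch m i" for i e
  proof -
    have "{j. j \<in> {1..m} \<and> e \<in> branch m j} = {i}"
      using that disjoint_branches[OF m] unfolding disjoint_family_on_def by blast
    then show ?thesis
      unfolding x_def by simp
  qed
  moreover have "integral_on (branch_arcs m) x" if "\<forall>i\<in>{1..m}. y i \<in> \<int>"
    using that x unfolding integral_on_def branch_arcs_def by auto
  ultimately show ?thesis
    using unit_flow_branches_iff[OF m] y by blast
qed

section \<open>Splitting vertices\<close>

definition fractional_matching :: "'v set \<Rightarrow> 'v set \<Rightarrow> ('v \<times> 'v) set \<Rightarrow> ('v \<times> 'v \<Rightarrow> real) \<Rightarrow> bool" where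
  "fractional_matching L R E x \<longleftrightarrow>
     (\<forall>j\<in>R. (\<Sum>i | (i, j) \<in> E. x (i, j)) = 1) \<and>
     (\<forall>i\<in>L. (\<Sum>j | (i, j) \<in> E. x (i, j)) = 1) \<and>
     (\<forall>e\<in>E. 0 \<le> x e \<and> x e \<le> 1)"

lemma LP_LBO_PM_iff:
  "LP_LBO_PM L R E S x z \<longleftrightarrow> fractional_matching L R E x \<and> budget_constraints E S x z"
  unfolding LP_LBO_PM_def fractional_matching_def by auto

text \<open>The left copy of \<open>v\<close> is \<open>2 * v\<close>, the right copy is \<open>2 * v + 1\<close>.\<close>

definition split_arc :: "nat \<times> nat \<Rightarrow> nat \<times> nat" where
  "split_arc = (\<lambda>(u, v). (2 * u, 2 * v + 1))"

text \<open>The edge joining the two copies of \<open>v\<close> is encoded as the image of the loop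
  \<open>(v, v)\<close>, so that \<open>split_arc\<close> treats it like an arc. Source and sink get
  no such edge.\<close>

definition split_edges :: "nat set \<Rightarrow> (nat \<times> nat) set \<Rightarrow> nat \<Rightarrow> nat \<Rightarrow> (nat \<times> nat) set" where
  "split_edges V A s t = split_arc ` (A \<union> (\<lambda>v. (v, v)) ` (V - {s, t}))"

text \<open>Omitting the left copy of the sink here, and the right copy of the source below,
  balances the two sides and forces one unit out of the source and into the sink.\<close>

definition split_left :: "nat set \<Rightarrow> nat \<Rightarrow> nat set" where
  "split_left V t = (\<lambda>v. 2 * v) ` (V - {t})"

definition split_right :: "nat set \<Rightarrow> nat \<Rightarrow> nat set" where
  "split_right V s = (\<lambda>v. 2 * v + 1) ` (V - {s})"

lemma inj_split_arc: "inj split_arc"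
  unfolding split_arc_def by (auto intro!: injI)

lemma split_edges_iff:
  "(i, j) \<in> split_edges V A s t \<longleftrightarrow>
    (\<exists>u v. i = 2 * u \<and> j = 2 * v + 1 \<and> ((u, v) \<in> A \<or> u = v \<and> v \<in> V - {s, t}))"
  unfolding split_edges_def split_arc_def by force

text \<open>The edges at the left copy of \<open>v\<close> are its outgoing arcs and, for internal
  \<open>v\<close>, the joining edge; the absence of loops in \<open>A\<close> prevents double
  counting.\<close>

lemma sum_split_edges_out:
  fixes x :: "nat \<times> nat \<Rightarrow> real"
  assumes "finite A" "(v, v) \<notin> A"
  shows "(\<Sum>j | (2 * v, j) \<in> split_edges V A s t. x (2 * v, j)) =
    (\<Sum>w | (v, w) \<in> A. x (split_arc (v, w))) + (if v \<in> V - {s, t} then x (split_arc (v, v)) else 0)"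
proof -
  define W where "W = {w. (v, w) \<in> A}"
  define D where "D = (if v \<in> V - {s, t} then {v} else {})"
  have "W \<subseteq> snd ` A"
    unfolding W_def by force
  then have "finite W"
    using assms(1) by (meson finite_imageI finite_subset)
  have "{j. (2 * v, j) \<in> split_edges V A s t} = (\<lambda>w. 2 * w + 1) ` (W \<union> D)"
    unfolding W_def D_def by (auto simp: split_edges_iff)
  moreover have "inj_on (\<lambda>w::nat. 2 * w + 1) (W \<union> D)"
    by (rule inj_onI) simp
  ultimately have "(\<Sum>j | (2 * v, j) \<in> split_edges V A s t. x (2 * v, j)) =
      (\<Sum>w\<in>W \<union> D. x (split_arc (v, w)))"
    by (simp add: sum.reindex split_arc_def)
  also have "\<dots> = (\<Sum>w\<in>W. x (split_arc (v, w))) + (\<Sum>w\<in>D. x (split_arc (v, w)))"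
    using \<open>finite W\<close> assms(2) by (intro sum.union_disjoint) (auto simp: W_def D_def)
  finally show ?thesis
    unfolding W_def D_def by simp
qed

lemma sum_split_edges_in:
  fixes x :: "nat \<times> nat \<Rightarrow> real"
  assumes "finite A" "(v, v) \<notin> A"
  shows "(\<Sum>i | (i, 2 * v + 1) \<in> split_edges V A s t. x (i, 2 * v + 1)) =
    (\<Sum>u | (u, v) \<in> A. x (split_arc (u, v))) + (if v \<in> V - {s, t} then x (split_arc (v, v)) else 0)"
proof -
  define U where "U = {u. (u, v) \<in> A}"
  define D where "D = (if v \<in> V - {s, t} then {v} else {})"
  have "U \<subseteq> fst ` A"
    unfolding U_def by force
  then have "finite U"
    using assms(1) by (meson finite_imageI finite_subset)
  have "{i. (i, 2 * v + 1) \<in> split_edges V A s t} = (\<lambda>u. 2 * u) ` (U \<union> D)"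
    unfolding U_def D_def by (auto simp: split_edges_iff)
  moreover have "inj_on (\<lambda>u::nat. 2 * u) (U \<union> D)"
    by (rule inj_onI) simp
  ultimately have "(\<Sum>i | (i, 2 * v + 1) \<in> split_edges V A s t. x (i, 2 * v + 1)) =
      (\<Sum>u\<in>U \<union> D. x (split_arc (u, v)))"
    by (simp add: sum.reindex split_arc_def)
  also have "\<dots> = (\<Sum>u\<in>U. x (split_arc (u, v))) + (\<Sum>u\<in>D. x (split_arc (u, v)))"
    using \<open>finite U\<close> assms(2) by (intro sum.union_disjoint) (auto simp: U_def D_def)
  finally show ?thesis
    unfolding U_def D_def by simp
qed

text \<open>The two copies of an internal vertex share their joining edge. Both have total 1, so
  cancelling that edge leaves conservation; at source and sink there is nothing to cancel.\<close>

lemma unit_flow_of_matching: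
  assumes "finite A" "\<And>v. (v, v) \<notin> A" "s \<in> V" "t \<in> V" "s \<noteq> t"
    and x: "fractional_matching (split_left V t) (split_right V s) (split_edges V A s t) x"
  shows "unit_flow V A s t (x \<circ> split_arc)"
proof -
  have out: "(\<Sum>w | (v, w) \<in> A. x (split_arc (v, w))) +
      (if v \<in> V - {s, t} then x (split_arc (v, v)) else 0) = 1" if "v \<in> V - {t}" for v
    using x that unfolding sum_split_edges_out[OF assms(1,2), symmetric]
    by (auto simp: fractional_matching_def split_left_def)
  have into: "(\<Sum>u | (u, v) \<in> A. x (split_arc (u, v))) +
      (if v \<in> V - {s, t} then x (split_arc (v, v)) else 0) = 1" if "v \<in> V - {s}" for v
    using x that unfolding sum_split_edges_in[OF assms(1,2), symmetric]
    by (auto simp: fractional_matching_def split_right_def)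
  show ?thesis
    unfolding unit_flow_def comp_def
  proof (intro conjI ballI)
    fix v assume v: "v \<in> V - {s, t}"
    show "(\<Sum>w | (v, w) \<in> A. x (split_arc (v, w))) = (\<Sum>u | (u, v) \<in> A. x (split_arc (u, v)))"
      using out[of v] into[of v] v by simp
  next
    show "(\<Sum>w | (s, w) \<in> A. x (split_arc (s, w))) = 1"
      using out[of s] assms by simp
  next
    show "(\<Sum>u | (u, t) \<in> A. x (split_arc (u, t))) = 1"
      using into[of t] assms by simp
  next
    fix e assume "e \<in> A"
    then have "split_arc e \<in> split_edges V A s t"
      unfolding split_edges_def by blast
    then show "0 \<le> x (split_arc e)" "x (split_arc e) \<le> 1"
      using x unfolding fractional_matching_def by auto
  qed
qed

text \<open>The slack \<open>1 - flow\<close> on the joining edge completes the left copy to total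
  1, and by conservation also the right copy. The bound \<open>through\<close> keeps it nonnegative,
  and it is an integer whenever the flow is integral.\<close>

lemma matching_of_unit_flow:
  assumes "finite A" "\<And>v. (v, v) \<notin> A"
    and x: "unit_flow V A s t x"
    and through: "\<And>v. v \<in> V - {s, t} \<Longrightarrow> (\<Sum>w | (v, w) \<in> A. x (v, w)) \<le> 1"
  shows "\<exists>x'. fractional_matching (split_left V t) (split_right V s) (split_edges V A s t) x' \<and>
    (\<forall>e\<in>A. x' (split_arc e) = x e) \<and> (integral_on A x \<longrightarrow> integral_on (split_edges V A s t) x')"
proof -
  \<comment> \<open>The test \<open>u = v\<close> singles out the joining edges unambiguously
    because \<open>A\<close> has no loops.\<close>
  define f where "f = (\<lambda>(u, v). if u = v then 1 - (\<Sum>w | (v, w) \<in> A. x (v, w)) else x (u, v))"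
  define x' where "x' = f \<circ> inv split_arc"
  have x'_split: "x' (split_arc e) = f e" for e
    unfolding x'_def by (simp add: inv_f_f[OF inj_split_arc])
  have x'_arc: "x' (split_arc (u, v)) = x (u, v)" if "(u, v) \<in> A" for u v
    unfolding x'_split f_def using that assms(2) by auto
  have x'_diag: "x' (split_arc (v, v)) = 1 - (\<Sum>w | (v, w) \<in> A. x (v, w))" for v
    unfolding x'_split f_def by simp
  have out: "(\<Sum>w | (v, w) \<in> A. x' (split_arc (v, w))) = (\<Sum>w | (v, w) \<in> A. x (v, w))" for v
    using x'_arc by (intro sum.cong) auto
  have into: "(\<Sum>u | (u, v) \<in> A. x' (split_arc (u, v))) = (\<Sum>u | (u, v) \<in> A. x (u, v))" for v
    using x'_arc by (intro sum.cong) auto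
  have nonneg: "0 \<le> (\<Sum>w | (v, w) \<in> A. x (v, w))" for v
    using x unfolding unit_flow_def by (intro sum_nonneg) auto
  have "fractional_matching (split_left V t) (split_right V s) (split_edges V A s t) x'"
    unfolding fractional_matching_def
  proof (intro conjI ballI)
    fix j assume "j \<in> split_right V s"
    then obtain v where v: "v \<in> V - {s}" "j = 2 * v + 1"
      unfolding split_right_def by blast
    show "(\<Sum>i | (i, j) \<in> split_edges V A s t. x' (i, j)) = 1"
      unfolding v(2) sum_split_edges_in[OF assms(1,2)] into
      using x v(1) by (cases "v = t") (auto simp: x'_diag unit_flow_def)
  next
    fix i assume "i \<in> split_left V t"
    then obtain v where v: "v \<in> V - {t}" "i = 2 * v"
      unfolding split_left_def by blast
    show "(\<Sum>j | (i, j) \<in> split_edges V A s t. x' (i, j)) = 1"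
      unfolding v(2) sum_split_edges_out[OF assms(1,2)] out
      using x v(1) by (cases "v = s") (auto simp: x'_diag unit_flow_def)
  next
    fix e assume "e \<in> split_edges V A s t"
    then consider a where "a \<in> A" "e = split_arc a" | v where "v \<in> V - {s, t}" "e = split_arc (v, v)"
      unfolding split_edges_def by blast
    then have "0 \<le> x' e \<and> x' e \<le> 1"
    proof cases
      case 1
      then show ?thesis
        using x x'_arc[of "fst a" "snd a"] unfolding unit_flow_def by auto
    next
      case 2
      then show ?thesis
        using through[of v] nonneg[of v] by (simp add: x'_diag)
    qed
    then show "0 \<le> x' e" "x' e \<le> 1" by auto
  qed
  moreover have "integral_on (split_edges V A s t) x'" if "integral_on A x"
    using that x'_arc unfolding integral_on_def split_edges_def
    by (auto simp: x'_diag intro!: Ints_diff Ints_sum)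
  ultimately show ?thesis
    using x'_arc by auto
qed

text \<open>Each side omits one vertex of \<open>V\<close>, which gives equal sizes, and parity
  separates the sides. Arcs leaving \<open>t\<close> or entering \<open>s\<close> are excluded
  because they would have no endpoint on the corresponding side.\<close>

lemma LogBgt_PerMat_instance_split:
  assumes "finite V" "A \<subseteq> (V - {t}) \<times> (V - {s})" "s \<in> V" "t \<in> V"
    and "budget_sets (split_edges V A s t) S"
  shows "LogBgt_PerMat_instance (split_left V t) (split_right V s) (split_edges V A s t) S"
  unfolding LogBgt_PerMat_instance_def
proof (intro conjI)
  show "split_left V t \<inter> split_right V s = {}"
    unfolding split_left_def split_right_def by auto presburger
  have "card (split_left V t) = card (V - {t})" "card (split_right V s) = card (V - {s})"
    unfolding split_left_def split_right_def by (auto intro!: card_image inj_onI)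
  then show "card (split_left V t) = card (split_right V s)"
    using assms by simp
  show "split_edges V A s t \<subseteq> split_left V t \<times> split_right V s"
    using assms(2) unfolding split_edges_def split_arc_def split_left_def split_right_def by auto
qed (use assms in \<open>auto simp: split_left_def split_right_def\<close>)

section \<open>The two families of instances\<close>

lemma branch_arcs_subset:
  assumes "m \<ge> 1"
  shows "branch_arcs m \<subseteq> (branch_verts m - {1}) \<times> (branch_verts m - {0})"
proof
  fix e assume "e \<in> branch_arcs m"
  moreover from this obtain i k where "k < m * 2 ^ i" "e = (node m i k, node m i (Suc k))"
    by (elim branch_arcsE)
  ultimately show "e \<in> (branch_verts m - {1}) \<times> (branch_verts m - {0})"
    using node_eq_1_iff[OF assms, of i k] unfolding branch_verts_def by force
qed

lemma branch_arcs_loopfree: "m \<ge> 1 \<Longrightarrow> (v, v) \<notin> branch_arcs m"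
proof
  assume m: "m \<ge> 1" and "(v, v) \<in> branch_arcs m"
  then obtain i k where ik: "k < m * 2 ^ i" "node m i k = node m i (Suc k)"
    by (auto elim!: branch_arcsE)
  show False
  proof (cases "k = 0")
    case True
    then show ?thesis using ik(2) node_eq_0_iff[of m i "Suc k"] by simp
  next
    case False
    then show ?thesis using ik node_eq_internal_iff[of k m i i "Suc k"] by simp
  qed
qed

lemma source_sink_in_branch_verts:
  assumes "m \<ge> 1"
  shows "0 \<in> branch_verts m" "1 \<in> branch_verts m"
proof -
  have "(node m 1 0, node m 1 1) \<in> branch_arcs m"
    using branch_arcsI[of 1 m 0] assms by simp
  then show "0 \<in> branch_verts m"
    unfolding branch_verts_def by force
  have "(node m 1 (m * 2 ^ 1 - 1), node m 1 (m * 2 ^ 1)) \<in> branch_arcs m"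
    using branch_arcsI[of 1 m "m * 2 ^ 1 - 1"] assms by simp
  then show "1 \<in> branch_verts m"
    using node_end[OF assms, of 1] unfolding branch_verts_def by force
qed

text \<open>The single outgoing arc of an internal vertex has capacity 1; this makes the slack on
  the joining edge nonnegative.\<close>

lemma flow_through_le_1:
  assumes "m \<ge> 1" "unit_flow (branch_verts m) (branch_arcs m) 0 1 x" "v \<in> branch_verts m - {0, 1}"
  shows "(\<Sum>w | (v, w) \<in> branch_arcs m. x (v, w)) \<le> 1"
proof -
  obtain i k where ik: "i \<in> {1..m}" "0 < k" "k < m * 2 ^ i" "v = node m i k"
    using assms by (blast elim: branch_vertsE)
  then show ?thesis
    using assms(2) branch_arcsI[of i m k] by (simp add: branch_arcs_successors unit_flow_def)
qed

text \<open>One instance for each \<open>m\<close>; the bound \<open>m \<le> card A\<close> is what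
  later yields infinitely many sizes.\<close>

lemma path_instance:
  assumes m: "m \<ge> 1"
  defines "A \<equiv> branch_arcs m"
  shows "\<exists>(G :: nat pair_pre_digraph) s t S.
    LogBgt_Path_instance G s t S \<and> card (parcs G) = card A \<and>
    gap_well_defined (parcs G) (LP_LBO_Path G s t S) \<and>
    integrality_gap (parcs G) (LP_LBO_Path G s t S) \<ge> 1 / 5 * log 2 (real (card A))"
    and "m \<le> card A"
proof -
  define G where "G = \<lparr>pverts = branch_verts m, parcs = A\<rparr>"
  let ?S = "\<lambda>i. if i \<in> {1..m} then branch m i else {}"
  let ?P = "LP_LBO_Path G 0 1 ?S"
  let ?Q = "unit_flow (branch_verts m) A 0 1"
  \<comment> \<open>The exponent \<open>3 * m\<close> is relaxed to \<open>5 * m\<close>, the common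
    bound for paths and matchings.\<close>
  have le: "card A \<le> 2 ^ (5 * m)"
    unfolding A_def
    by (rule order.trans[OF card_branch_arcs_le[OF m]]) (simp add: power_increasing)
  have fin: "finite A"
    unfolding A_def by simp
  have sub: "branch m i \<subseteq> A" if "i \<in> {1..m}" for i
    using that unfolding A_def branch_arcs_def by blast
  have card: "card (branch m i) = m * 2 ^ i" if "i \<in> {1..m}" for i
    using that m by (simp add: card_branch)
  have P: "?P x z \<longleftrightarrow> ?Q x \<and> budget_constraints A ?S x z" for x z
    unfolding LP_LBO_Path_iff by (simp add: G_def)
  have decompose:
    "\<exists>y. (\<forall>i\<in>{1..m}. 0 \<le> y i) \<and> sum y {1..m} = 1 \<and> (\<forall>i\<in>{1..m}. \<forall>e\<in>branch m i. x e = y i)"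
    if "?Q x" for x
    using that unfolding A_def unit_flow_branches_iff[OF m] .
  have compose: "\<exists>x. ?Q x \<and> (\<forall>i\<in>{1..m}. \<forall>e\<in>branch m i. x e = y i) \<and>
      ((\<forall>i\<in>{1..m}. y i \<in> \<int>) \<longrightarrow> integral_on A x)"
    if "\<forall>i\<in>{1..m}. 0 \<le> y i" "sum y {1..m} = 1" for y
    unfolding A_def by (rule ex_unit_flow_branches[OF m that])
  have gap: "budget_sets A ?S" "gap_well_defined A ?P"
    "integrality_gap A ?P \<ge> 1 / 5 * log 2 (real (card A))" "m \<le> card A"
    by (rule integrality_gap_branches[where E = A and m = m and B = "branch m" and Q = ?Q and P = ?P];
        fact fin m disjoint_branches[OF m] sub card le P decompose compose)+
  have "pair_digraph G"
  proof
    fix e assume "e \<in> parcs G"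
    then show "fst e \<in> pverts G" "snd e \<in> pverts G" "fst e \<noteq> snd e"
      using branch_arcs_loopfree[OF m, of "fst e"]
      by (auto simp: G_def A_def branch_verts_def) (metis prod.collapse)
  qed (auto simp: G_def A_def branch_verts_def)
  then have "LogBgt_Path_instance G 0 1 ?S"
    unfolding LogBgt_Path_instance_def
    using source_sink_in_branch_verts[OF m] gap(1) by (simp add: G_def)
  then show "\<exists>(G :: nat pair_pre_digraph) s t S.
    LogBgt_Path_instance G s t S \<and> card (parcs G) = card A \<and>
    gap_well_defined (parcs G) (LP_LBO_Path G s t S) \<and>
    integrality_gap (parcs G) (LP_LBO_Path G s t S) \<ge> 1 / 5 * log 2 (real (card A))"
    using gap(2,3) by (intro exI[of _ G] exI[of _ 0] exI[of _ 1] exI[of _ ?S]) (simp add: G_def)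
  show "m \<le> card A" by (fact gap(4))
qed

lemma matching_instance:
  assumes m: "m \<ge> 1"
  defines "F \<equiv> split_edges (branch_verts m) (branch_arcs m) 0 1"
  shows "\<exists>(L :: nat set) R E S.
    LogBgt_PerMat_instance L R E S \<and> card E = card F \<and>
    gap_well_defined E (LP_LBO_PM L R E S) \<and>
    integrality_gap E (LP_LBO_PM L R E S) \<ge> 1 / 5 * log 2 (real (card F))"
    and "m \<le> card F"
proof -
  let ?V = "branch_verts m" and ?A = "branch_arcs m"
  let ?L = "split_left ?V 1" and ?R = "split_right ?V 0"
  let ?Q = "fractional_matching ?L ?R F"
  define B where "B = (\<lambda>i. split_arc ` branch m i)"
  let ?S = "\<lambda>i. if i \<in> {1..m} then B i else {}"
  let ?P = "LP_LBO_PM ?L ?R F ?S"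
  have finV: "finite ?V"
    unfolding branch_verts_def by simp
  \<comment> \<open>There is one edge per arc and one per internal vertex, and at most two vertices
    per arc. The total is at most \<open>3 * card ?A\<close>, hence below
    \<open>2 ^ (3 * m + 2)\<close>, and \<open>m \<ge> 1\<close> gives the exponent
    \<open>5 * m\<close>.\<close>
  have "card F \<le> card (?A \<union> (\<lambda>v. (v, v)) ` (?V - {0, 1}))"
    unfolding F_def split_edges_def using finV by (intro card_image_le) auto
  also have "\<dots> \<le> card ?A + card ((\<lambda>v. (v, v)) ` (?V - {0, 1}))"
    by (rule card_Un_le)
  also have "\<dots> \<le> card ?A + card ?V"
    using finV by (intro add_mono order.trans[OF card_image_le] card_mono) auto
  also have "\<dots> \<le> card ?A + (card ?A + card ?A)"
    unfolding branch_verts_def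
    by (intro add_mono order.trans[OF card_Un_le] card_image_le) auto
  also have "\<dots> \<le> 2 ^ 2 * 2 ^ (3 * m)"
    using card_branch_arcs_le[OF m] by simp
  also have "\<dots> \<le> 2 ^ (5 * m)"
    unfolding power_add[symmetric] using m by (intro power_increasing) auto
  finally have le: "card F \<le> 2 ^ (5 * m)" .
  have fin: "finite F"
    unfolding F_def split_edges_def using finV by simp
  have disj: "disjoint_family_on B {1..m}"
    using disjoint_branches[OF m] unfolding disjoint_family_on_def B_def
    by (simp add: image_Int[OF inj_split_arc, symmetric])
  have sub: "B i \<subseteq> F" if "i \<in> {1..m}" for i
    using that unfolding B_def F_def split_edges_def branch_arcs_def by blast
  have card: "card (B i) = m * 2 ^ i" if "i \<in> {1..m}" for i
    unfolding B_def using that m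
    by (simp add: card_branch card_image inj_on_subset[OF inj_split_arc])
  have decompose:
    "\<exists>y. (\<forall>i\<in>{1..m}. 0 \<le> y i) \<and> sum y {1..m} = 1 \<and> (\<forall>i\<in>{1..m}. \<forall>e\<in>B i. x e = y i)"
    if "?Q x" for x
  proof -
    have "unit_flow ?V ?A 0 1 (x \<circ> split_arc)"
      using that branch_arcs_loopfree[OF m] source_sink_in_branch_verts[OF m]
      unfolding F_def by (intro unit_flow_of_matching) auto
    then show ?thesis
      unfolding unit_flow_branches_iff[OF m] B_def by auto
  qed
  \<comment> \<open>The branch flow with values \<open>y\<close> is turned into a matching that
    keeps these values on the images of the arcs.\<close>
  have compose: "\<exists>x. ?Q x \<and> (\<forall>i\<in>{1..m}. \<forall>e\<in>B i. x e = y i) \<and>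
      ((\<forall>i\<in>{1..m}. y i \<in> \<int>) \<longrightarrow> integral_on F x)"
    if y: "\<forall>i\<in>{1..m}. 0 \<le> y i" "sum y {1..m} = 1" for y
  proof -
    obtain x where x: "unit_flow ?V ?A 0 1 x" "\<forall>i\<in>{1..m}. \<forall>e\<in>branch m i. x e = y i"
        "(\<forall>i\<in>{1..m}. y i \<in> \<int>) \<longrightarrow> integral_on ?A x"
      using ex_unit_flow_branches[OF m y] by blast
    obtain x' where x': "?Q x'" "\<forall>e\<in>?A. x' (split_arc e) = x e"
        "integral_on ?A x \<longrightarrow> integral_on F x'"
      using matching_of_unit_flow[OF finite_branch_arcs branch_arcs_loopfree[OF m] x(1)
          flow_through_le_1[OF m x(1)]]
      unfolding F_def by blast
    have "x' e = y i" if "i \<in> {1..m}" "e \<in> B i" for i e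
      using that x(2) x'(2) unfolding B_def branch_arcs_def by auto
    then show ?thesis
      using x x' by blast
  qed
  have gap: "budget_sets F ?S" "gap_well_defined F ?P"
    "integrality_gap F ?P \<ge> 1 / 5 * log 2 (real (card F))" "m \<le> card F"
    by (rule integrality_gap_branches[where E = F and m = m and B = B and Q = ?Q and P = ?P];
        fact fin m disj sub card le LP_LBO_PM_iff decompose compose)+
  have "LogBgt_PerMat_instance ?L ?R F ?S"
    unfolding F_def using finV branch_arcs_subset[OF m] source_sink_in_branch_verts[OF m] gap(1)
    by (intro LogBgt_PerMat_instance_split) (auto simp: F_def)
  then show "\<exists>(L :: nat set) R E S.
    LogBgt_PerMat_instance L R E S \<and> card E = card F \<and>
    gap_well_defined E (LP_LBO_PM L R E S) \<and>
    integrality_gap E (LP_LBO_PM L R E S) \<ge> 1 / 5 * log 2 (real (card F))"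
    using gap(2,3) by (intro exI[of _ ?L] exI[of _ ?R] exI[of _ F] exI[of _ ?S]) simp
  show "m \<le> card F" by (fact gap(4))
qed

lemma infinite_Collect_unbounded:
  fixes f :: "nat \<Rightarrow> nat"
  assumes "\<And>m. m \<ge> 1 \<Longrightarrow> p (f m)" "\<And>m. m \<ge> 1 \<Longrightarrow> m \<le> f m"
  shows "infinite {n. p n}"
  unfolding infinite_nat_iff_unbounded_le
proof
  fix k
  show "\<exists>n\<ge>k. n \<in> {n. p n}"
    using assms[of "Suc k"] by (intro exI[of _ "f (Suc k)"]) auto
qed

theorem theorem7p2:
  shows "(\<exists>c::real. c > 0 \<and>
           infinite {n::nat. \<exists>(G :: nat pair_pre_digraph) s t S.
             LogBgt_Path_instance G s t S \<and> card (parcs G) = n \<and>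
             gap_well_defined (parcs G) (LP_LBO_Path G s t S) \<and>
             integrality_gap (parcs G) (LP_LBO_Path G s t S) \<ge> c * log 2 (real n)})
       \<and> (\<exists>c::real. c > 0 \<and>
           infinite {n::nat. \<exists>(L :: nat set) R E S.
             LogBgt_PerMat_instance L R E S \<and> card E = n \<and>
             gap_well_defined E (LP_LBO_PM L R E S) \<and>
             integrality_gap E (LP_LBO_PM L R E S) \<ge> c * log 2 (real n)})"
\<comment> \<open>The constant reflects the size bound \<open>2 ^ (5 * m)\<close> against a gap of
  at least \<open>m\<close>.\<close>
proof (intro conjI exI[of _ "1 / 5 :: real"])
  show "infinite {n::nat. \<exists>(G :: nat pair_pre_digraph) s t S.
      LogBgt_Path_instance G s t S \<and> card (parcs G) = n \<and>
      gap_well_defined (parcs G) (LP_LBO_Path G s t S) \<and>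
      integrality_gap (parcs G) (LP_LBO_Path G s t S) \<ge> 1 / 5 * log 2 (real n)}"
    by (rule infinite_Collect_unbounded[where f = "\<lambda>m. card (branch_arcs m)"])
      (fact path_instance)+
  show "infinite {n::nat. \<exists>(L :: nat set) R E S.
      LogBgt_PerMat_instance L R E S \<and> card E = n \<and>
      gap_well_defined E (LP_LBO_PM L R E S) \<and>
      integrality_gap E (LP_LBO_PM L R E S) \<ge> 1 / 5 * log 2 (real n)}"
    by (rule infinite_Collect_unbounded[where
          f = "\<lambda>m. card (split_edges (branch_verts m) (branch_arcs m) 0 1)"])
      (fact matching_instance)+
qed simp_all

end
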